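(* Let $q$ be a prime power and let $n \geq 2$ be an integer. The length of the shortest cycle in the graph $A(n,q)$ containing the point $(0)=(0,0,\dots,0)$ is at least $2n+2$; that is, every cycle of $A(n,q)$ passing through the point $(0)$ has length at least $2n+2$.
   Context: Let $\mathbb{F}_q$ be the finite field of order $q$, $q$ a prime power. For $n \geq 2$ let $P$ and $L$ be two disjoint copies of $\mathbb{F}_q^n$; elements of $P$ are called points and written $(p)=(p_1,\dots,p_n)$, and elements of $L$ are called lines and written $[\ell]=[\ell_1,\dots,\ell_n]$. The point $(0,0,\dots,0)\in P$ is denoted $(0)$. The graph $A(n,q)$ is the simple undirected bipartite graph with vertex set $P \sqcup L$ (parts $P$ and $L$) in which the point $(p)$ is adjacent to the line $[\ell]$ if and only if for all $2 \leq j \leq n$, $$p_j+\ell_j = \begin{cases} p_{j-1}\,\ell_1 & \text{if } j \text{ is even},\\ p_1\,\ell_{j-1} & \text{if } j \text{ is odd}.\end{cases}$$ *)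

theory Defs
  imports
    "HOL-Library.FuncSet"
    "HOL-Library.Cardinality"
    "HOL-Number_Theory.Prime_Powers"
    "Graph_Theory.Graph_Theory"
begin

text \<open>
  The field of order \<open>q\<close> is a type \<open>'a\<close> of class \<open>field\<close> with \<open>CARD('a) = q\<close>. Elements of its
  \<open>n\<close>-th power are extensional functions on \<open>{1..n}\<close>, so that coordinates are numbered from 1.
\<close>

definition coord_space :: "nat \<Rightarrow> (nat \<Rightarrow> 'a) set" where
  "coord_space n = {1..n} \<rightarrow>\<^sub>E UNIV"

datatype 'a vertex = Point "nat \<Rightarrow> 'a" | Line "nat \<Rightarrow> 'a"

definition incident :: "nat \<Rightarrow> (nat \<Rightarrow> 'a::field) \<Rightarrow> (nat \<Rightarrow> 'a) \<Rightarrow> bool" where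
  "incident n p l \<longleftrightarrow>
     (\<forall>j\<in>{2..n}. p j + l j = (if even j then p (j - 1) * l 1 else p 1 * l (j - 1)))"

text \<open>
  An undirected edge is represented by its two orientations, following the library's
  representation of simple graphs (locale \<open>pair_graph\<close>).
\<close>

definition A_graph :: "nat \<Rightarrow> 'a::field vertex pair_pre_digraph" where
  "A_graph n =
     \<lparr> pverts = Point ` coord_space n \<union> Line ` coord_space n,
       parcs = {(Point p, Line l) | p l.
                  p \<in> coord_space n \<and> l \<in> coord_space n \<and> incident n p l} \<union>
               {(Line l, Point p) | p l.
                  p \<in> coord_space n \<and> l \<in> coord_space n \<and> incident n p l} \<rparr>"

lemma pair_graph_A_graph: "pair_graph (A_graph n :: 'a::{field,finite} vertex pair_pre_digraph)"
proof -
  let ?G = "A_graph n :: 'a vertex pair_pre_digraph"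
  have fin: "finite (pverts ?G)"
    by (simp add: A_graph_def coord_space_def finite_PiE)
  have sub: "parcs ?G \<subseteq> pverts ?G \<times> pverts ?G"
    by (auto simp: A_graph_def)
  show ?thesis
  proof
    show "finite (parcs ?G)"
      using sub fin by (meson finite_SigmaI finite_subset)
    show "symmetric (with_proj ?G)"
      by (auto simp: symmetric_def sym_def A_graph_def)
  qed (use fin sub in \<open>auto simp: A_graph_def\<close>)
qed

definition zero_point :: "nat \<Rightarrow> 'a::zero vertex" where
  "zero_point n = Point (\<lambda>i\<in>{1..n}. 0)"

text \<open>
  The directed \<open>cycle\<close> of the library also admits \<open>u, v, u\<close>, which traverses one edge back and
  forth. In a simple graph the bound on the length rules out exactly these.
\<close>

definition undirected_cycle :: "('v, 'e) pre_digraph \<Rightarrow> 'e awalk \<Rightarrow> bool" where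
  "undirected_cycle G c \<longleftrightarrow> pre_digraph.cycle G c \<and> 3 \<le> length c"

definition cycle_verts :: "('v, 'e) pre_digraph \<Rightarrow> 'e awalk \<Rightarrow> 'v set" where
  "cycle_verts G c = tail G ` set c"

end

theory Submission
  imports Defs "HOL-Number_Theory.Cong"
begin

text \<open>
  Call the odd coordinates of a point and the even coordinates of a line its core coordinates.
  On two successive edges \<open>u, v, w\<close> the adjacency relations give
  \<open>w\<^sub>j = u\<^sub>j + v\<^sub>j\<^sub>-\<^sub>1 (w\<^sub>1 - u\<^sub>1)\<close> for core indices \<open>j\<close>, and \<open>w\<^sub>1 \<noteq> u\<^sub>1\<close> if \<open>w \<noteq> u\<close>.
  So along a non-backtracking walk from \<open>(0)\<close> the last nonzero core coordinate of the
  vertex at step \<open>s \<ge> 2\<close> has index \<open>s - 1\<close>. In a cycle of length \<open>2k\<close> with \<open>k \<le> n\<close>, the vertex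
  at step \<open>k + 1\<close> is also reached in \<open>k - 1\<close> steps the other way around: its core coordinate of
  index \<open>k\<close> is nonzero by the first walk and zero by the second.
\<close>

section \<open>Adjacency relations, uniformly for points and lines\<close>

fun coords :: "'a vertex \<Rightarrow> nat \<Rightarrow> 'a" where
  "coords (Point p) = p"
| "coords (Line l) = l"

fun is_line :: "'a vertex \<Rightarrow> bool" where
  "is_line (Point p) = False"
| "is_line (Line l) = True"

lemma A_graph_arc_sym: "(u, v) \<in> parcs (A_graph n) \<Longrightarrow> (v, u) \<in> parcs (A_graph n)"
  by (auto simp: A_graph_def)

lemma A_graph_bipartite: "(u, v) \<in> parcs (A_graph n) \<Longrightarrow> is_line v \<longleftrightarrow> \<not> is_line u"
  by (auto simp: A_graph_def)

text \<open>The parity condition makes \<open>j\<close> a core index of \<open>u\<close>. It selects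
  the odd relation for a point and the even one for a line, and in both the product pairs the first
  coordinate of \<open>u\<close> with the preceding coordinate of \<open>v\<close>.\<close>

lemma A_graph_coords_add:
  assumes "(u, v) \<in> parcs (A_graph n)" "j \<in> {2..n}" "even j \<longleftrightarrow> is_line u"
  shows "coords u j + coords v j = coords v (j - 1) * coords u 1"
proof (cases u)
  case (Point p)
  then obtain l where "v = Line l" "incident n p l"
    using assms(1) by (auto simp: A_graph_def)
  then show ?thesis
    using Point assms(2,3) by (simp add: incident_def mult.commute)
next
  case (Line l)
  then obtain p where "v = Point p" "incident n p l"
    using assms(1) by (auto simp: A_graph_def)
  then show ?thesis
    using Line assms(2,3) by (simp add: incident_def add.commute)
qed

text \<open>Subtracting the relations of the two edges at \<open>j\<close> eliminates
  \<open>coords v j\<close>, which is not a core coordinate of \<open>v\<close>; the remaining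
  factor \<open>coords v (j - 1)\<close> is one if \<open>v\<close> is read with its own
  parity.\<close>

lemma A_graph_coords_step:
  fixes u v w :: "'a::field vertex"
  assumes uv: "(u, v) \<in> parcs (A_graph n)" and vw: "(v, w) \<in> parcs (A_graph n)"
    and j: "j \<in> {2..n}" and parity: "even j \<longleftrightarrow> is_line u"
  shows "coords w j = coords u j + coords v (j - 1) * (coords w 1 - coords u 1)"
proof -
  have "is_line w = is_line u"
    using A_graph_bipartite[OF uv] A_graph_bipartite[OF vw] by simp
  then have "coords w j + coords v j = coords v (j - 1) * coords w 1"
    using A_graph_coords_add[OF A_graph_arc_sym[OF vw] j] parity by simp
  moreover have "coords u j + coords v j = coords v (j - 1) * coords u 1"
    using A_graph_coords_add[OF uv j parity] .
  ultimately have "coords w j - coords u j =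
      coords v (j - 1) * coords w 1 - coords v (j - 1) * coords u 1"
    by (metis add_diff_cancel_right)
  then show ?thesis
    by (simp add: algebra_simps)
qed

text \<open>For fixed \<open>p\<close>, the relation at \<open>j\<close> solves for
  \<open>l j\<close> in terms of \<open>l 1\<close> and \<open>l (j - 1)\<close>, so the first
  coordinate determines the others recursively.\<close>

lemma incident_line_cong:
  assumes "incident n p l" "incident n p l'" "l 1 = l' 1" "j \<in> {1..n}"
  shows "l j = l' j"
  using assms(4)
proof (induction j)
  case 0
  then show ?case by simp
next
  case (Suc j)
  show ?case
  proof (cases "j = 0")
    case True
    then show ?thesis using assms(3) by simp
  next
    case False
    then have j: "Suc j \<in> {2..n}" and IH: "l j = l' j"
      using Suc by auto
    have "p (Suc j) + l (Suc j) = p (Suc j) + l' (Suc j)"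
      using assms(1,2)[unfolded incident_def, rule_format, OF j] assms(3) IH by simp
    then show ?thesis by simp
  qed
qed

lemma incident_point_cong:
  assumes "incident n p l" "incident n p' l" "p 1 = p' 1" "j \<in> {1..n}"
  shows "p j = p' j"
  using assms(4)
proof (induction j)
  case 0
  then show ?case by simp
next
  case (Suc j)
  show ?case
  proof (cases "j = 0")
    case True
    then show ?thesis using assms(3) by simp
  next
    case False
    then have j: "Suc j \<in> {2..n}" and IH: "p j = p' j"
      using Suc by auto
    have "p (Suc j) + l (Suc j) = p' (Suc j) + l (Suc j)"
      using assms(1,2)[unfolded incident_def, rule_format, OF j] assms(3) IH by simp
    then show ?thesis by simp
  qed
qed

text \<open>Used contrapositively: if a walk does not backtrack, the factor
  \<open>coords w 1 - coords u 1\<close> in \<open>A_graph_coords_step\<close> is nonzero.\<close>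

lemma A_graph_neighbour_eqI:
  assumes "(u, v) \<in> parcs (A_graph n)" "(v, w) \<in> parcs (A_graph n)"
    and eq: "coords u 1 = coords w 1"
  shows "u = w"
proof (cases v)
  case (Point p)
  then obtain l l' where "u = Line l" "w = Line l'"
      "l \<in> coord_space n" "l' \<in> coord_space n" "incident n p l" "incident n p l'"
    using assms(1,2) by (auto simp: A_graph_def)
  moreover from this have "l = l'"
    using eq incident_line_cong[of n p l l'] unfolding coord_space_def
    by (elim PiE_ext) simp_all
  ultimately show ?thesis
    by simp
next
  case (Line l)
  then obtain p p' where "u = Point p" "w = Point p'"
      "p \<in> coord_space n" "p' \<in> coord_space n" "incident n p l" "incident n p' l"
    using assms(1,2) by (auto simp: A_graph_def)
  moreover from this have "p = p'"
    using eq incident_point_cong[of n p l p'] unfolding coord_space_def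
    by (elim PiE_ext) simp_all
  ultimately show ?thesis
    by simp
qed

section \<open>Non-backtracking walks from the zero point\<close>

lemma A_graph_walk_is_line:
  assumes "v 0 = zero_point n"
    and "\<And>i. i < m \<Longrightarrow> (v i, v (Suc i)) \<in> parcs (A_graph n)"
    and "s \<le> m"
  shows "is_line (v s) \<longleftrightarrow> odd s"
  using assms(3)
proof (induction s)
  case 0
  then show ?case using assms(1) by (simp add: zero_point_def)
next
  case (Suc s)
  then show ?case using A_graph_bipartite[OF assms(2)[of s]] by simp
qed

text \<open>The condition \<open>odd (s + j)\<close> singles out the core indices of
  \<open>v s\<close>. Both claims go through one induction, since nonvanishing at step
  \<open>s\<close> needs vanishing at step \<open>s - 2\<close> and nonvanishing at step
  \<open>s - 1\<close>.\<close>

lemma A_graph_walk_coords: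
  fixes v :: "nat \<Rightarrow> 'a::field vertex"
  assumes start: "v 0 = zero_point n"
    and arc: "\<And>i. i < m \<Longrightarrow> (v i, v (Suc i)) \<in> parcs (A_graph n)"
    and nonbacktracking: "\<And>i. i + 2 \<le> m \<Longrightarrow> v (i + 2) \<noteq> v i"
    and "s \<le> m"
  shows "(\<forall>j\<in>{max 1 s..n}. odd (s + j) \<longrightarrow> coords (v s) j = 0) \<and>
         (s \<in> {2..n + 1} \<longrightarrow> coords (v s) (s - 1) \<noteq> 0)"
  using \<open>s \<le> m\<close>
proof (induction s rule: less_induct)
  case (less s)
  have zero: "coords (v 0) j = 0" if "j \<in> {1..n}" for j
    using that start by (simp add: zero_point_def)
  consider "s = 0" | "s = 1" | r where "s = r + 2"
    by (metis One_nat_def add_2_eq_Suc' not0_implies_Suc)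
  then show ?case
  proof cases
    case 1
    then show ?thesis using zero by simp
  next
    case 2
    \<comment> \<open>No vertex lies two steps back, so the relation on the single edge to the zero
      point is used instead.\<close>
    have "coords (v 1) j = 0" if "j \<in> {1..n}" "odd (1 + j)" for j
    proof -
      have j: "j \<in> {2..n}" "even j"
        using that by (auto simp: Suc_le_eq elim: evenE)
      have "is_line (v 1)"
        using A_graph_walk_is_line[of v n m 1] start arc less.prems 2 by simp
      moreover have "(v 1, v 0) \<in> parcs (A_graph n)"
        using A_graph_arc_sym arc[of 0] less.prems 2 by simp
      ultimately have "coords (v 1) j + coords (v 0) j = coords (v 0) (j - 1) * coords (v 1) 1"
        using A_graph_coords_add j by blast
      then show ?thesis
        using zero[of j] zero[of "j - 1"] j by fastforce
    qed
    then show ?thesis using 2 by simp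
  next
    case (3 r)
    have uv: "(v r, v (r + 1)) \<in> parcs (A_graph n)"
      and vw: "(v (r + 1), v (r + 2)) \<in> parcs (A_graph n)"
      using arc[of r] arc[of "r + 1"] less.prems 3 by auto
    have neq: "coords (v (r + 2)) 1 \<noteq> coords (v r) 1"
      using A_graph_neighbour_eqI[OF uv vw] nonbacktracking[of r] less.prems 3 by metis
    have line: "is_line (v r) \<longleftrightarrow> odd r"
      using A_graph_walk_is_line[of v n m r] start arc less.prems 3 by simp
    have step: "coords (v (r + 2)) j =
        coords (v r) j + coords (v (r + 1)) (j - 1) * (coords (v (r + 2)) 1 - coords (v r) 1)"
      if "j \<in> {2..n}" "odd (r + j)" for j
      using that line by (intro A_graph_coords_step[OF uv vw]) auto
    have IH0: "coords (v r) j = 0" if "j \<in> {max 1 r..n}" "odd (r + j)" for j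
      using less.IH[of r] less.prems 3 that by simp
    have IH1: "coords (v (r + 1)) j = 0" if "j \<in> {r + 1..n}" "odd (r + 1 + j)" for j
      using less.IH[of "r + 1"] less.prems 3 that by simp
    have IH2: "coords (v (r + 1)) r \<noteq> 0" if "r \<in> {1..n}"
      using less.IH[of "r + 1"] less.prems 3 that by simp
    have "coords (v (r + 2)) j = 0" if "j \<in> {r + 2..n}" "odd (r + 2 + j)" for j
      using that step[of j] IH0[of j] IH1[of "j - 1"] by (cases j) auto
    moreover have "coords (v (r + 2)) (r + 1) \<noteq> 0" if "r + 1 \<le> n"
    \<comment> \<open>For \<open>r = 0\<close> the index is 1, where \<open>step\<close> does not
      apply, and the claim is \<open>neq\<close> with \<open>v 0\<close> zero. Otherwise
      \<open>IH0\<close> kills the first summand of \<open>step\<close>, leaving a product of two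
      nonzero factors.\<close>
    proof (cases "r = 0")
      case True
      then show ?thesis using neq zero[of 1] that by simp
    next
      case False
      then show ?thesis
        using that step[of "r + 1"] IH0[of "r + 1"] IH2 neq by simp
    qed
    ultimately show ?thesis using 3 by simp
  qed
qed

section \<open>Cycles as periodic vertex sequences\<close>

lemma (in pre_digraph) cas_nth:
  "cas u p v \<Longrightarrow> Suc i < length p \<Longrightarrow> head G (p ! i) = tail G (p ! Suc i)"
proof (induction p arbitrary: u i)
  case (Cons e p)
  then show ?case by (cases i; cases p) auto
qed simp

lemma (in pre_digraph) cas_head_last: "cas u p v \<Longrightarrow> p \<noteq> [] \<Longrightarrow> head G (last p) = v"
  by (induction p arbitrary: u) auto

text \<open>Starting the cycle at \<open>w\<close> and extending it periodically to all indices
  removes wrap-around cases later; the last property encodes both closure and distinctness.\<close>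

lemma (in pre_digraph) cycle_rotationE:
  assumes "cycle c" "w \<in> cycle_verts G c"
  obtains v where "v 0 = w"
    and "\<forall>i. \<exists>e\<in>arcs G. tail G e = v i \<and> head G e = v (Suc i)"
    and "\<forall>i j. v i = v j \<longleftrightarrow> i mod length c = j mod length c"
proof -
  let ?N = "length c"
  obtain u where u: "awalk u c u" and dist: "distinct (tl (awalk_verts u c))" and "c \<noteq> []"
    using assms(1) unfolding cycle_def by blast
  then have cas: "cas u c u" and sub: "set c \<subseteq> arcs G"
    by (auto simp: awalk_def)
  have hd: "tail G (hd c) = u"
    using cas \<open>c \<noteq> []\<close> by (simp add: cas_simp)
  have last: "head G (last c) = u"
    using cas_head_last[OF cas \<open>c \<noteq> []\<close>] .
  \<comment> \<open>The library's condition omits the first vertex \<open>u\<close> but keeps its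
    repetition at the end; the tails are the same vertices with \<open>u\<close> moved to the
    front.\<close>
  have tails: "distinct (map (tail G) c)"
    using dist hd last \<open>c \<noteq> []\<close> by (cases c) (auto simp: awalk_verts_conv)
  obtain r where r: "r < ?N" "tail G (c ! r) = w"
    using assms(2) by (auto simp: cycle_verts_def in_set_conv_nth)
  define v where "v i = tail G (c ! ((i + r) mod ?N))" for i
  have "v 0 = w"
    using r by (simp add: v_def)
  moreover have "\<exists>e\<in>arcs G. tail G e = v i \<and> head G e = v (Suc i)" for i
  proof (intro bexI conjI)
    let ?k = "(i + r) mod ?N"
    have k: "?k < ?N"
      using \<open>c \<noteq> []\<close> by simp
    then show "c ! ?k \<in> arcs G"
      using sub nth_mem by blast
    show "head G (c ! ?k) = v (Suc i)"
    proof (cases "Suc ?k = ?N")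
      case True
      then have "c ! ?k = last c"
        using \<open>c \<noteq> []\<close> by (metis diff_Suc_1 last_conv_nth)
      moreover have "(Suc i + r) mod ?N = 0"
        using True by (simp add: mod_Suc)
      ultimately show ?thesis
        using hd last \<open>c \<noteq> []\<close> by (simp add: v_def hd_conv_nth)
    next
      case False
      then have "(Suc i + r) mod ?N = Suc ?k"
        by (simp add: mod_Suc)
      then show ?thesis
        using cas_nth[OF cas, of ?k] False k by (simp add: v_def)
    qed
  qed (simp add: v_def)
  moreover have "v i = v j \<longleftrightarrow> i mod ?N = j mod ?N" for i j
  proof -
    have "v i = v j \<longleftrightarrow> (i + r) mod ?N = (j + r) mod ?N"
      using nth_eq_iff_index_eq[OF tails, of "(i + r) mod ?N" "(j + r) mod ?N"] \<open>c \<noteq> []\<close>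
      by (simp add: v_def)
    also have "\<dots> \<longleftrightarrow> i mod ?N = j mod ?N"
      using cong_add_rcancel_nat[of i r j ?N] by (simp add: cong_def)
    finally show ?thesis .
  qed
  ultimately show thesis
    using that by blast
qed

theorem theorem2p3:
  fixes q n :: nat
    and c :: "('a::{field,finite} vertex \<times> 'a vertex) awalk"
  assumes "primepow q"
    and "CARD('a) = q"
    and "n \<ge> 2"
    and "undirected_cycle (with_proj (A_graph n)) c"
    and "zero_point n \<in> cycle_verts (with_proj (A_graph n)) c"
  shows "2 * n + 2 \<le> length c"
proof (rule ccontr)
  let ?N = "length c"
  assume short: "\<not> 2 * n + 2 \<le> ?N"
  have N: "3 \<le> ?N" and cycle: "pre_digraph.cycle (with_proj (A_graph n)) c"
    using assms(4) by (auto simp: undirected_cycle_def)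
  obtain v :: "nat \<Rightarrow> 'a vertex" where v0: "v 0 = zero_point n"
    and v_arc: "\<forall>i. \<exists>e\<in>arcs (with_proj (A_graph n)).
        tail (with_proj (A_graph n)) e = v i \<and> head (with_proj (A_graph n)) e = v (Suc i)"
    and v_eq: "\<forall>i j. v i = v j \<longleftrightarrow> i mod ?N = j mod ?N"
    by (rule pre_digraph.cycle_rotationE[OF cycle assms(5)])
  have arc: "(v i, v (Suc i)) \<in> parcs (A_graph n)" for i
    using v_arc[rule_format, of i] by auto
  have nonbacktracking: "v (i + 2) \<noteq> v i" for i
  proof
    assume "v (i + 2) = v i"
    then have "[i + 2 = i] (mod ?N)"
      by (simp add: v_eq cong_def)
    \<comment> \<open>Here the bound \<open>3 \<le> length c\<close> excludes going back and forth
      along one edge.\<close>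
    then have "?N dvd 2"
      by (simp only: cong_add_lcancel_0_nat cong_0_iff)
    then show False
      using N by (auto dest: dvd_imp_le)
  qed
  have vN: "v ?N = v 0"
    by (simp add: v_eq)
  then have "even ?N"
    using A_graph_walk_is_line[of v n ?N ?N] v0 arc by (auto simp: zero_point_def)
  then obtain k where k: "?N = 2 * k"
    by (elim evenE)
  \<comment> \<open>An even length below \<open>2 * n + 2\<close> is at most
    \<open>2 * n\<close>.\<close>
  have "2 \<le> k" "k \<le> n"
    using N short k by auto
  have "coords (v (k + 1)) k \<noteq> 0"
    using A_graph_walk_coords[of v n ?N "k + 1"] v0 arc nonbacktracking \<open>2 \<le> k\<close> \<open>k \<le> n\<close> k
    by simp
  moreover have "coords (v (k + 1)) k = 0"
  proof -
    \<comment> \<open>The same cycle traversed backwards. Truncated subtraction makes this a walk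
      only up to step \<open>?N\<close>, which is why the walk lemmas carry a bound
      \<open>m\<close>.\<close>
    define b where "b i = v (?N - i)" for i
    have "b 0 = zero_point n"
      by (simp add: b_def vN v0)
    moreover have "(b i, b (Suc i)) \<in> parcs (A_graph n)" if "i < ?N" for i
      using A_graph_arc_sym[OF arc[of "?N - Suc i"]] that
      by (simp add: b_def Suc_diff_Suc)
    moreover have "b (i + 2) \<noteq> b i" if "i + 2 \<le> ?N" for i
    proof -
      have "?N - (i + 2) + 2 = ?N - i"
        using that by simp
      then show ?thesis
        using nonbacktracking[of "?N - (i + 2)"] by (simp add: b_def)
    qed
    ultimately have "\<forall>j\<in>{max 1 (k - 1)..n}. odd (k - 1 + j) \<longrightarrow> coords (b (k - 1)) j = 0"
      using A_graph_walk_coords[of b n ?N "k - 1"] k by simp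
    \<comment> \<open>The two directions meet here because
      \<open>2 * k - (k - 1) = k + 1\<close>.\<close>
    moreover have "b (k - 1) = v (k + 1)"
      using \<open>2 \<le> k\<close> by (simp add: b_def k)
    moreover have "odd (k - 1 + k)"
      using \<open>2 \<le> k\<close> by presburger
    ultimately show ?thesis
      using \<open>2 \<le> k\<close> \<open>k \<le> n\<close> by auto
  qed
  ultimately show False
    by contradiction
qed

end
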